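(* Let $\mathbb{K}$ be a field of characteristic $0$ and let $A$ be an anti-associative algebra over $\mathbb{K}$. Then $A$ is nilpotent of nilindex $4$.
   Context: An algebra over $\mathbb{K}$ is a $\mathbb{K}$-vector space $A$ equipped with a bilinear multiplication $A\times A\to A$, $(x,y)\mapsto xy$. It is anti-associative if $(xy)z+x(yz)=0$ for all $x,y,z\in A$. An algebra $A$ is called nilpotent if there exists an integer $k$ such that all products of $k$ elements of $A$ are $0$. The nilindex of $A$ is the smallest integer $k$ such that the subspace $A^k$ generated by all the products of degree $k$ (that is, products of $k$ elements of $A$) is zero.
   Formalization: "Nilindex 4" is read as nilindex at most 4, together with the existence over each such field of a 3-dimensional anti-associative algebra of nilindex exactly 4, since an algebra with zero multiplication is anti-associative with nilindex at most 2. *)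

theory Defs
  imports "HOL-Analysis.Cartesian_Space"
begin

locale algebra_over = vector_space smul
  for smul :: "'k::field \<Rightarrow> 'a::ab_group_add \<Rightarrow> 'a" +
  fixes mul :: "'a \<Rightarrow> 'a \<Rightarrow> 'a"
  assumes linear_left: "Vector_Spaces.linear smul smul (\<lambda>x. mul x y)"
    and linear_right: "Vector_Spaces.linear smul smul (\<lambda>y. mul x y)"

locale anti_associative_algebra = algebra_over +
  assumes anti_assoc: "mul (mul x y) z + mul x (mul y z) = 0"

text \<open>The multiplication need not be associative, so a product of \<open>k\<close> elements
  may be bracketed in any way.\<close>

inductive is_product :: "('a \<Rightarrow> 'a \<Rightarrow> 'a) \<Rightarrow> nat \<Rightarrow> 'a \<Rightarrow> bool"
  for mul :: "'a \<Rightarrow> 'a \<Rightarrow> 'a" where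
  single: "is_product mul 1 x"
| mult: "is_product mul m x \<Longrightarrow> is_product mul n y \<Longrightarrow> is_product mul (m + n) (mul x y)"

text \<open>Degree \<open>0\<close> has to be excluded below: \<open>is_product mul 0 x\<close> never holds,
  so every algebra would satisfy the conditions with \<open>k = 0\<close>.\<close>

definition nilpotent_algebra :: "('a::zero \<Rightarrow> 'a \<Rightarrow> 'a) \<Rightarrow> bool" where
  "nilpotent_algebra mul \<longleftrightarrow> (\<exists>k\<ge>1. \<forall>x. is_product mul k x \<longrightarrow> x = 0)"

definition power_subspace ::
  "('k::field \<Rightarrow> 'a::ab_group_add \<Rightarrow> 'a) \<Rightarrow> ('a \<Rightarrow> 'a \<Rightarrow> 'a) \<Rightarrow> nat \<Rightarrow> 'a set" where
  "power_subspace smul mul k = module.span smul {x. is_product mul k x}"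

text \<open>Only meaningful for nilpotent algebras; the algebra \<open>{0}\<close> has nilindex \<open>1\<close>.\<close>

definition nilindex ::
  "('k::field \<Rightarrow> 'a::ab_group_add \<Rightarrow> 'a) \<Rightarrow> ('a \<Rightarrow> 'a \<Rightarrow> 'a) \<Rightarrow> nat" where
  "nilindex smul mul = (LEAST k. k \<ge> 1 \<and> power_subspace smul mul k = {0})"

end

theory Submission
  imports Defs
begin

text \<open>Moving all brackets of a product of four elements to the right takes three
  applications of the identity along one side of the associativity pentagon and two along the
  other. Hence \<open>((ab)c)d\<close> equals both \<open>a(b(cd))\<close> and its negative, so all products of degree
  \<open>4\<close> vanish unless the characteristic is \<open>2\<close>. The bound is attained by the algebra with basis
  \<open>e\<^sub>1, e\<^sub>2, e\<^sub>3\<close> and non-zero products \<open>e\<^sub>1 e\<^sub>1 = e\<^sub>2\<close>, \<open>e\<^sub>1 e\<^sub>2 = e\<^sub>3\<close>, \<open>e\<^sub>2 e\<^sub>1 = - e\<^sub>3\<close>.\<close>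

lemma is_product_degree_pos: "is_product mul n x \<Longrightarrow> 1 \<le> n"
  by (induction rule: is_product.induct) auto

lemma is_product_2E:
  assumes "is_product mul 2 x"
  obtains a b where "x = mul a b"
  using assms by cases auto

lemma is_product_3E:
  assumes "is_product mul 3 x"
  obtains a b c where "x = mul (mul a b) c \<or> x = mul a (mul b c)"
  using assms
proof cases
  case (mult m y n z)
  then have "m = 1 \<and> n = 2 \<or> m = 2 \<and> n = 1"
    using is_product_degree_pos[of mul m y] is_product_degree_pos[of mul n z] by linarith
  then show thesis
    using mult that by (metis is_product_2E)
qed simp

text \<open>As factors have degree at least 1, the outermost product splits 4 as 1 + 3, 2 + 2 or 3 +
  1. These splits give 2 + 1 + 2 = 5 bracketings.\<close>

lemma is_product_4E:
  assumes "is_product mul 4 x"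
  obtains a b c d where
    "x = mul (mul (mul a b) c) d \<or> x = mul (mul a (mul b c)) d \<or> x = mul (mul a b) (mul c d) \<or>
     x = mul a (mul (mul b c) d) \<or> x = mul a (mul b (mul c d))"
  using assms
proof cases
  case (mult m y n z)
  then consider "m = 1" "n = 3" | "m = 2" "n = 2" | "m = 3" "n = 1"
    using is_product_degree_pos[of mul m y] is_product_degree_pos[of mul n z] by linarith
  then show thesis
  proof cases
    case 1
    then obtain p q r where "z = mul (mul p q) r \<or> z = mul p (mul q r)"
      using mult is_product_3E by metis
    then show thesis using mult(2) that by blast
  next
    case 2
    then obtain p q r s where "y = mul p q" "z = mul r s"
      using mult is_product_2E by metis
    then show thesis using mult(2) that by blast
  next
    case 3
    then obtain p q r where "y = mul (mul p q) r \<or> y = mul p (mul q r)"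
      using mult is_product_3E by metis
    then show thesis using mult(2) that by blast
  qed
qed simp

context algebra_over
begin

lemma mul_minus_left: "mul (- x) y = - mul x y"
  using module_hom.neg[OF linear_left[unfolded linear_iff_module_hom]] .

lemma mul_minus_right: "mul x (- y) = - mul x y"
  using module_hom.neg[OF linear_right[unfolded linear_iff_module_hom]] .

end

context anti_associative_algebra
begin

lemma mul_mul_left: "mul (mul x y) z = - mul x (mul y z)"
  using anti_assoc by (simp add: eq_neg_iff_add_eq_0)

text \<open>In this context \<open>'a\<close> is the type of scalars, so the assumption only
  excludes characteristic 2.\<close>

lemma mul4_eq_0:
  assumes "(2::'a) \<noteq> 0"
  shows "mul a (mul b (mul c d)) = 0"
proof -
  \<comment> \<open>The long side: ((ab)c)d = -(a(bc))d = a((bc)d) = -a(b(cd)).\<close>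
  have "mul (mul (mul a b) c) d = - mul a (mul b (mul c d))"
    by (simp only: mul_mul_left[of a b c] mul_mul_left[of a "mul b c" d] mul_mul_left[of b c d]
      mul_minus_left mul_minus_right minus_minus)
  \<comment> \<open>The short side: ((ab)c)d = -(ab)(cd) = a(b(cd)).\<close>
  moreover have "mul (mul (mul a b) c) d = mul a (mul b (mul c d))"
    by (simp only: mul_mul_left[of "mul a b" c d] mul_mul_left[of a b "mul c d"] minus_minus)
  ultimately have "smul 2 (mul a (mul b (mul c d))) = 0"
    using scale_left_distrib[of 1 1 "mul a (mul b (mul c d))"] by (simp add: eq_neg_iff_add_eq_0)
  then show ?thesis
    using assms by simp
qed

text \<open>Each bracketing is, up to sign, one rebracketing away from one already known to vanish,
  starting from the fully right-nested one.\<close>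

lemma is_product_4_eq_0:
  assumes "(2::'a) \<noteq> 0" "is_product mul 4 x"
  shows "x = 0"
proof -
  note right = mul4_eq_0[OF assms(1)]
  have right_left: "mul a (mul (mul b c) d) = 0" for a b c d
    by (simp only: mul_mul_left[of b] mul_minus_right right minus_zero)
  have middle: "mul (mul a b) (mul c d) = 0" for a b c d
    by (simp only: mul_mul_left[of a] right minus_zero)
  have left_right: "mul (mul a (mul b c)) d = 0" for a b c d
    by (simp only: mul_mul_left[of a] right_left minus_zero)
  have left: "mul (mul (mul a b) c) d = 0" for a b c d
    by (simp only: mul_mul_left[of "mul a b"] middle minus_zero)
  obtain a b c d where "x = mul (mul (mul a b) c) d \<or> x = mul (mul a (mul b c)) d \<or>
     x = mul (mul a b) (mul c d) \<or> x = mul a (mul (mul b c) d) \<or> x = mul a (mul b (mul c d))"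
    using assms(2) by (rule is_product_4E)
  then show ?thesis
    by (elim disjE) (simp_all only: left left_right middle right_left right)
qed

lemma nilpotent:
  assumes "(2::'a) \<noteq> 0"
  shows "nilpotent_algebra mul"
  unfolding nilpotent_algebra_def
  using is_product_4_eq_0[OF assms] by (intro exI[of _ 4]) auto

lemma power_subspace_4:
  assumes "(2::'a) \<noteq> 0"
  shows "power_subspace smul mul 4 = {0}"
proof -
  have "power_subspace smul mul 4 \<subseteq> {0}"
    unfolding power_subspace_def using is_product_4_eq_0[OF assms]
    by (intro span_minimal subspace_single_0) auto
  moreover have "0 \<in> power_subspace smul mul 4"
    unfolding power_subspace_def by (rule span_zero)
  ultimately show ?thesis
    by blast
qed

lemma nilindex_le_4:
  assumes "(2::'a) \<noteq> 0"
  shows "nilindex smul mul \<le> 4"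
  unfolding nilindex_def using power_subspace_4[OF assms] by (intro Least_le) simp

lemma nilindex_eq_4:
  assumes two: "(2::'a) \<noteq> 0" and nz: "mul a (mul b c) \<noteq> 0"
  shows "nilindex smul mul = 4"
  unfolding nilindex_def
proof (rule Least_equality)
  fix k assume k: "1 \<le> k \<and> power_subspace smul mul k = {0}"
  have prod1: "is_product mul 1 x" for x
    by (rule is_product.single)
  have prod2: "is_product mul 2 (mul x y)" for x y
    using is_product.mult[OF prod1[of x] prod1[of y]] by (simp only: one_add_one)
  have prod3: "is_product mul 3 (mul x (mul y z))" for x y z
    using is_product.mult[OF prod1[of x] prod2[of y z]]
    by (simp only: one_plus_numeral add_num_simps)
  have zero: "x = 0" if "is_product mul k x" for x
    using k span_base[of x "{x. is_product mul k x}"] that by (auto simp: power_subspace_def)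
  show "4 \<le> k"
  proof (rule ccontr)
    assume "\<not> 4 \<le> k"
    with k consider "k = 1" | "k = 2" | "k = 3" by linarith
    \<comment> \<open>The element a(bc) is at once a product of degree 1, of degree 2 (factors a and
      bc) and of degree 3, so it alone refutes every smaller k.\<close>
    then have "is_product mul k (mul a (mul b c))"
      by cases (simp_all only: prod1 prod2 prod3)
    then have "mul a (mul b c) = 0"
      by (rule zero)
    with nz show False ..
  qed
qed (simp add: power_subspace_4[OF two])

end

text \<open>Outside characteristic 2 this is the free anti-associative algebra on one generator
  \<open>axis 1 1\<close>, written in coordinates.\<close>

definition witness_mul :: "'k::field ^ 3 \<Rightarrow> 'k ^ 3 \<Rightarrow> 'k ^ 3" where
  "witness_mul x y =
    (\<chi> i. if i = 2 then x $ 1 * y $ 1 else if i = 3 then x $ 1 * y $ 2 - x $ 2 * y $ 1 else 0)"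

text \<open>Only the third coordinate of a triple product can be non-zero: it is -x1 y1 z1 for (xy)z
  and x1 y1 z1 for x(yz).\<close>

lemma anti_associative_witness: "anti_associative_algebra (*s) (witness_mul :: 'k::field ^ 3 \<Rightarrow> _)"
proof (intro anti_associative_algebra.intro algebra_over.intro)
  show "vector_space ((*s) :: 'k \<Rightarrow> 'k ^ 3 \<Rightarrow> _)"
    by unfold_locales
  show "algebra_over_axioms (*s) (witness_mul :: 'k ^ 3 \<Rightarrow> _)"
    by unfold_locales (auto simp: witness_mul_def vec_eq_iff algebra_simps)
  show "anti_associative_algebra_axioms (witness_mul :: 'k ^ 3 \<Rightarrow> _)"
    by unfold_locales (auto simp: witness_mul_def vec_eq_iff algebra_simps)
qed

lemma witness_mul_nonzero:
  "witness_mul (axis 1 1) (witness_mul (axis 1 1) (axis 1 1)) \<noteq> (0 :: 'k::field ^ 3)"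
proof
  assume "witness_mul (axis 1 1) (witness_mul (axis 1 1) (axis 1 1)) = (0 :: 'k ^ 3)"
  \<comment> \<open>The product is the third basis vector, so its third coordinate is 1.\<close>
  then have "witness_mul (axis 1 1) (witness_mul (axis 1 1) (axis 1 1)) $ 3 = (0 :: 'k ^ 3) $ 3"
    by (rule arg_cong)
  then show False
    by (simp add: witness_mul_def axis_def)
qed

text \<open>Zero multiplication gives nilindex at most 2, so nilindex 4 is read as a sharp upper
  bound: it holds for every algebra and is attained over the same field.\<close>

theorem proposition2:
  fixes smul :: "'k::field_char_0 \<Rightarrow> 'a::ab_group_add \<Rightarrow> 'a"
    and mul :: "'a \<Rightarrow> 'a \<Rightarrow> 'a"
  assumes "anti_associative_algebra smul mul"
  shows "nilpotent_algebra mul \<and> nilindex smul mul \<le> 4 \<and>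
    (\<exists>mul' :: 'k ^ 3 \<Rightarrow> 'k ^ 3 \<Rightarrow> 'k ^ 3.
       anti_associative_algebra (*s) mul' \<and> nilpotent_algebra mul' \<and> nilindex (*s) mul' = 4)"
proof -
  have two: "(2::'k) \<noteq> 0"
    by simp
  interpret A: anti_associative_algebra smul mul
    by fact
  interpret W: anti_associative_algebra "(*s)" "witness_mul :: 'k ^ 3 \<Rightarrow> _"
    by (rule anti_associative_witness)
  show ?thesis
    using A.nilpotent[OF two] A.nilindex_le_4[OF two] anti_associative_witness
      W.nilpotent[OF two] W.nilindex_eq_4[OF two witness_mul_nonzero] by blast
qed

end
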